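(* Let $G$ be a finite simple graph of order $n\geq 3$. Then $\gamma_{\rm ri2}(G)=n-1$ if and only if $G$ has one connected component $G_1$, with $n_1=|V(G_1)|$, that is isomorphic to one of $S_{n_1-1}$ (with $n_1\geq 3$), $S_{n_1-1}^+$ (with $n_1\geq 3$), $S(n_1-3,1)$ (with $n_1\geq 4$), and $C_5$, and all other connected components of $G$ are isomorphic to $K_1$ or $K_2$.
   Context: A $2$-rainbow independent dominating function (2RiDF) of a graph $G$ is a function $f: V(G)\to\{0,1,2\}$ such that, writing $V_i=\{v: f(v)=i\}$, for each $i\in\{1,2\}$ the set $V_i$ is independent and every vertex $v$ with $f(v)=0$ has a neighbor $u$ with $f(u)=i$. Its weight is the number of vertices with nonzero value, and $\gamma_{\rm ri2}(G)$ is the minimum weight of a 2RiDF of $G$. The star $S_m$ ($m\geq 1$) is $K_{1,m}$. $S_m^+$ is the graph obtained from $S_m$ by adding a single edge (necessarily joining two leaves). For integers $n\geq m\geq 0$, the double star $S(n,m)$ has vertex set $\{u_0,\ldots,u_n,v_0,\ldots,v_m\}$ and edge set $\{u_0v_0\}\cup\{u_0u_i: 1\le i\le n\}\cup\{v_0v_j:1\le j\le m\}$. $C_5$ is the $5$-cycle; $K_1,K_2$ are complete graphs on $1$ and $2$ vertices. *)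

theory Defs
  imports "Graph_Theory.Graph_Theory"
begin

definition connected_components :: "('a, 'b) pre_digraph \<Rightarrow> ('a, 'b) pre_digraph set" where
  "connected_components G = {H. pre_digraph.max_subgraph G connected H}"

definition independent_set :: "('a, 'b) pre_digraph \<Rightarrow> 'a set \<Rightarrow> bool" where
  "independent_set G S \<longleftrightarrow> S \<subseteq> verts G \<and> (\<forall>u\<in>S. \<forall>v\<in>S. \<not> u \<rightarrow>\<^bsub>G\<^esub> v)"

definition is_2RiDF :: "('a, 'b) pre_digraph \<Rightarrow> ('a \<Rightarrow> nat) \<Rightarrow> bool" where
  "is_2RiDF G f \<longleftrightarrow>
     (\<forall>v\<in>verts G. f v \<in> {0, 1, 2}) \<and>
     (\<forall>i\<in>{1, 2}. independent_set G {v \<in> verts G. f v = i} \<and>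
        (\<forall>v\<in>verts G. f v = 0 \<longrightarrow> (\<exists>u\<in>verts G. v \<rightarrow>\<^bsub>G\<^esub> u \<and> f u = i)))"

definition weight :: "('a, 'b) pre_digraph \<Rightarrow> ('a \<Rightarrow> nat) \<Rightarrow> nat" where
  "weight G f = card {v \<in> verts G. f v \<noteq> 0}"

text \<open>Every finite simple graph has a 2RiDF (take \<open>V\<^sub>1\<close> a maximal independent set and \<open>V\<^sub>2\<close> a maximal
  independent set of the rest), so the minimum below is over a nonempty set.\<close>

definition gamma_ri2 :: "('a, 'b) pre_digraph \<Rightarrow> nat" where
  "gamma_ri2 G = (LEAST w. \<exists>f. is_2RiDF G f \<and> weight G f = w)"

text \<open>An undirected edge is a pair of opposite arcs; \<open>E\<close> lists each edge in one orientation.\<close>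

definition undirected :: "'a set \<Rightarrow> 'a rel \<Rightarrow> 'a pair_pre_digraph" where
  "undirected V E = \<lparr>pverts = V, parcs = E \<union> E\<inverse>\<rparr>"

definition star_edges :: "nat \<Rightarrow> nat rel" where
  "star_edges m = {(0, i) | i. 1 \<le> i \<and> i \<le> m}"

definition star :: "nat \<Rightarrow> nat pair_pre_digraph" where
  "star m = undirected {0..m} (star_edges m)"

text \<open>Meaningful for \<open>m \<ge> 2\<close> only; all choices of the added edge give isomorphic graphs.\<close>

definition star_plus :: "nat \<Rightarrow> nat pair_pre_digraph" where
  "star_plus m = undirected {0..m} (insert (1, 2) (star_edges m))"

text \<open>\<open>u\<^sub>i\<close> is \<open>Inl i\<close> and \<open>v\<^sub>j\<close> is \<open>Inr j\<close>.\<close>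

definition double_star :: "nat \<Rightarrow> nat \<Rightarrow> (nat + nat) pair_pre_digraph" where
  "double_star n m = undirected (Inl ` {0..n} \<union> Inr ` {0..m})
     ({(Inl 0, Inr 0)} \<union> {(Inl 0, Inl i) | i. 1 \<le> i \<and> i \<le> n} \<union> {(Inr 0, Inr j) | j. 1 \<le> j \<and> j \<le> m})"

definition cycle_graph :: "nat \<Rightarrow> nat pair_pre_digraph" where
  "cycle_graph k = undirected {0..<k} {(i, Suc i mod k) | i. i < k}"

lemma star_complete_bipartite: "complete_bipartite_digraph 1 m (star m)"
proof -
  have "{0..m} = {0} \<union> {1..m}" by auto
  moreover have "star_edges m \<union> (star_edges m)\<inverse> = {0} \<times> {1..m} \<union> {1..m} \<times> {0}"
    unfolding star_edges_def by auto
  moreover have "{0} \<inter> {1..m} = {}" "card {0::nat} = 1" "card {1..m} = m" by auto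
  ultimately show ?thesis
    unfolding complete_bipartite_digraph_pair_def star_def undirected_def
    by (simp only: pair_pre_digraph.simps) blast
qed

end

theory Submission
  imports Defs
begin

text \<open>
  Two disjoint independent sets \<open>A\<close>, \<open>B\<close> always extend greedily to a 2RiDF with \<open>A \<subseteq> V\<^sub>1\<close> and
  \<open>B \<subseteq> V\<^sub>2\<close>, and every vertex with a neighbour in \<open>A\<close> and one in \<open>B\<close> then gets the value 0. So a 2RiDF
  with a zero exists iff some vertex has two neighbours, and one with two zeros iff there is a certain
  configuration on at most six vertices. Excluding this configuration excludes 4-cycles, forces the ends of
  every 5-vertex path to be adjacent, and makes every 5-cycle a component of its own. If there is no 5-cycle,
  a vertex \<open>c\<close> of maximum degree has a star, a star plus an edge or an \<open>S(k, 1)\<close> as its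
  component, according to whether vertices at distance two from \<open>c\<close> and edges
  between neighbours of \<open>c\<close> exist. Two components with a vertex of degree at least two would
  yield two zeros.
\<close>

section \<open>Reduction to a local condition\<close>

text \<open>Stated for a bare arc relation, like \<open>two_zeros\<close> below, so that it applies
  alike to a graph, to one of its components and to an image under a vertex map.\<close>

definition branching :: "'a rel \<Rightarrow> bool" where
  "branching E \<longleftrightarrow> (\<exists>x a b. (x, a) \<in> E \<and> (x, b) \<in> E \<and> a \<noteq> b)"

text \<open>\<open>x\<close> and \<open>y\<close> are to receive 0, \<open>a\<close> and \<open>c\<close> the value 1, \<open>b\<close> and \<open>d\<close> the value 2;
  \<open>a = c\<close> and \<open>b = d\<close> are allowed.\<close>

definition two_zeros :: "'a rel \<Rightarrow> bool" where
  "two_zeros E \<longleftrightarrow> (\<exists>x y a b c d. x \<noteq> y \<and> (x, a) \<in> E \<and> (x, b) \<in> E \<and> (y, c) \<in> E \<and> (y, d) \<in> E \<and>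
     {x, y} \<inter> {a, b, c, d} = {} \<and> {a, c} \<inter> {b, d} = {} \<and> (a, c) \<notin> E \<and> (b, d) \<notin> E)"

lemma two_zerosI:
  assumes "(x, a) \<in> E" "(x, b) \<in> E" "(y, c) \<in> E" "(y, d) \<in> E"
    and "x \<noteq> y" "{x, y} \<inter> {a, b, c, d} = {}" "{a, c} \<inter> {b, d} = {}" "(a, c) \<notin> E" "(b, d) \<notin> E"
  shows "two_zeros E"
  using assms unfolding two_zeros_def by blast

lemma two_zerosE:
  assumes "two_zeros E"
  obtains x y a b c d where "(x, a) \<in> E" "(x, b) \<in> E" "(y, c) \<in> E" "(y, d) \<in> E"
    and "x \<noteq> y" "{x, y} \<inter> {a, b, c, d} = {}" "{a, c} \<inter> {b, d} = {}" "(a, c) \<notin> E" "(b, d) \<notin> E"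
  using assms unfolding two_zeros_def by (elim exE conjE) (rule that)

section \<open>2RiDFs from independent sets, and the number of zeros\<close>

context pair_graph
begin

lemma irrefl_arcs: "(x, x) \<notin> parcs G"
  using no_loops' by blast

text \<open>\<open>M\<close> is maximal among the independent sets that contain \<open>A\<close> and
  avoid \<open>B\<close>; \<open>N\<close> is maximal among those that contain \<open>B\<close> and
  avoid \<open>M\<close>. A vertex of value 0 lies outside \<open>M\<close> and \<open>N\<close>,
  hence outside \<open>B\<close> as well, so both maximality properties apply and yield neighbours
  of both values.\<close>

lemma extend_to_2RiDF:
  assumes "independent_set G A" "independent_set G B" "A \<inter> B = {}"
  obtains f where "is_2RiDF G f" "\<And>v. v \<in> A \<Longrightarrow> f v = 1" "\<And>v. v \<in> B \<Longrightarrow> f v = 2"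
proof -
  have maximal: "\<exists>M. I \<subseteq> M \<and> M \<subseteq> U \<and> independent_set G M \<and>
      (\<forall>v \<in> U - M. \<exists>u \<in> M. (v, u) \<in> parcs G)"
    if I: "independent_set G I" "I \<subseteq> U" and U: "U \<subseteq> pverts G" for I U
  proof -
    let ?F = "{J. J \<subseteq> U \<and> independent_set G J}"
    have "finite U" using U pair_finite_verts by (rule finite_subset)
    then have "finite ?F" by (auto intro: finite_subset[of _ "Pow U"])
    from finite_has_maximal2[OF this, of I] I obtain M where
      M: "I \<subseteq> M" "M \<subseteq> U" "independent_set G M"
      and max: "\<And>J. J \<subseteq> U \<Longrightarrow> independent_set G J \<Longrightarrow> M \<subseteq> J \<Longrightarrow> M = J"
      by auto
    have "\<exists>u \<in> M. (v, u) \<in> parcs G" if v: "v \<in> U - M" for v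
    proof (rule ccontr)
      assume "\<not> ?thesis"
      then have "independent_set G (insert v M)"
        using M(3) v U irrefl_arcs arcs_symmetric unfolding independent_set_def by auto
      then show False using max[of "insert v M"] M v by auto
    qed
    with M show ?thesis by blast
  qed
  have "A \<subseteq> pverts G - B" using assms by (auto simp: independent_set_def)
  with maximal[OF assms(1)] obtain M where M: "A \<subseteq> M" "M \<subseteq> pverts G - B"
      "independent_set G M" "\<And>v. v \<in> pverts G - B - M \<Longrightarrow> \<exists>u \<in> M. (v, u) \<in> parcs G"
    by (metis Diff_subset)
  have "B \<subseteq> pverts G - M" using M(2) assms by (auto simp: independent_set_def)
  with maximal[OF assms(2)] obtain N where N: "B \<subseteq> N" "N \<subseteq> pverts G - M"
      "independent_set G N" "\<And>v. v \<in> pverts G - M - N \<Longrightarrow> \<exists>u \<in> N. (v, u) \<in> parcs G"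
    by (metis Diff_subset)
  define f :: "'a \<Rightarrow> nat" where "f v = (if v \<in> M then 1 else if v \<in> N then 2 else 0)" for v
  have level: "{v \<in> pverts G. f v = 1} = M" "{v \<in> pverts G. f v = 2} = N"
    using M(2) N(2) by (auto simp: f_def)
  have dominated: "\<exists>u \<in> pverts G. (v, u) \<in> parcs G \<and> f u = i"
    if "v \<in> pverts G" "f v = 0" "i \<in> {1, 2}" for v i
  proof -
    have v: "v \<in> pverts G - B - M" "v \<in> pverts G - M - N"
      using that N(1) by (auto simp: f_def split: if_splits)
    show ?thesis
      using M(4)[OF v(1)] N(4)[OF v(2)] level that(3) by blast
  qed
  have "is_2RiDF G f"
    using M(3) N(3) level dominated unfolding is_2RiDF_def by (auto simp: f_def)
  moreover have "f v = 1" if "v \<in> A" for v using that M(1) by (auto simp: f_def)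
  moreover have "f v = 2" if "v \<in> B" for v using that N(1,2) by (auto simp: f_def)
  ultimately show thesis using that by blast
qed

lemma level_independent:
  assumes "is_2RiDF G f" "(a, c) \<in> parcs G" "f a = i" "i \<in> {1, 2}"
  shows "f c \<noteq> i"
proof -
  have "independent_set G {v \<in> pverts G. f v = i}"
    using assms(1,4) unfolding is_2RiDF_def by auto
  then show ?thesis
    using assms(2,3) in_arcsD1[OF assms(2)] in_arcsD2[OF assms(2)]
    unfolding independent_set_def by auto
qed

lemma zero_if_neighbors:
  assumes "is_2RiDF G f" "(x, a) \<in> parcs G" "(x, b) \<in> parcs G" "f a = 1" "f b = 2"
  shows "f x = 0"
proof -
  have "f x \<in> {0, 1, 2}" using assms(1) in_arcsD1[OF assms(2)] unfolding is_2RiDF_def by simp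
  moreover have "f x \<noteq> 1" "f x \<noteq> 2"
    using level_independent[OF assms(1)] assms(2-) by auto
  ultimately show ?thesis by blast
qed

lemma zero_imp_neighbors:
  assumes "is_2RiDF G f" "x \<in> pverts G" "f x = 0"
  obtains a b where "(x, a) \<in> parcs G" "(x, b) \<in> parcs G" "f a = 1" "f b = 2"
proof -
  have "\<exists>u \<in> pverts G. (x, u) \<in> parcs G \<and> f u = i" if "i \<in> {1, 2}" for i
    using assms that unfolding is_2RiDF_def by auto
  from this[of 1] this[of 2] that show thesis by auto
qed

text \<open>Turns small weight into many zeros: weight one below the order means exactly one
  zero.\<close>

lemma weight_plus_zeros:
  "weight G f + card {v \<in> pverts G. f v = 0} = card (pverts G)"
proof -
  have "card ({v \<in> pverts G. f v \<noteq> 0} \<union> {v \<in> pverts G. f v = 0}) = weight G f + card {v \<in> pverts G. f v = 0}"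
    unfolding weight_def with_proj_simps using pair_finite_verts by (intro card_Un_disjoint) auto
  moreover have "{v \<in> pverts G. f v \<noteq> 0} \<union> {v \<in> pverts G. f v = 0} = pverts G" by auto
  ultimately show ?thesis by simp
qed

lemma branching_if_zero:
  assumes "is_2RiDF G f" "x \<in> pverts G" "f x = 0"
  shows "branching (parcs G)"
proof -
  obtain a b where "(x, a) \<in> parcs G" "(x, b) \<in> parcs G" "f a = 1" "f b = 2"
    using zero_imp_neighbors[OF assms] .
  then show ?thesis unfolding branching_def by (metis one_eq_numeral_iff semiring_norm(85))
qed

text \<open>The configuration consists of the two zeros and the neighbours dominating them: equal
  values give the non-arcs, different values the disjointness.\<close>

lemma two_zeros_if_zeros:
  assumes f: "is_2RiDF G f" and x: "x \<in> pverts G" "f x = 0" and y: "y \<in> pverts G" "f y = 0"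
    and "x \<noteq> y"
  shows "two_zeros (parcs G)"
proof -
  obtain a b where ab: "(x, a) \<in> parcs G" "(x, b) \<in> parcs G" "f a = 1" "f b = 2"
    using zero_imp_neighbors[OF f x] .
  obtain c d where cd: "(y, c) \<in> parcs G" "(y, d) \<in> parcs G" "f c = 1" "f d = 2"
    using zero_imp_neighbors[OF f y] .
  have "(a, c) \<notin> parcs G" "(b, d) \<notin> parcs G"
    using level_independent[OF f] ab(3,4) cd(3,4) by auto
  moreover have "{x, y} \<inter> {a, b, c, d} = {}" "{a, c} \<inter> {b, d} = {}"
    using ab cd x y by auto
  ultimately show ?thesis using two_zerosI[OF ab(1,2) cd(1,2) \<open>x \<noteq> y\<close>] by blast
qed

lemma ex_zero_if_branching:
  assumes "branching (parcs G)"
  obtains f x where "is_2RiDF G f" "x \<in> pverts G" "f x = 0"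
proof -
  from assms obtain x a b where *: "(x, a) \<in> parcs G" "(x, b) \<in> parcs G" "a \<noteq> b"
    unfolding branching_def by blast
  have "independent_set G {a}" "independent_set G {b}" "{a} \<inter> {b} = {}"
    using * irrefl_arcs wellformed' by (auto simp: independent_set_def)
  then obtain f where "is_2RiDF G f" "f a = 1" "f b = 2"
    by (rule extend_to_2RiDF) auto
  with * zero_if_neighbors wellformed' that show thesis by blast
qed

text \<open>The two pairs are exactly what the greedy extension needs: disjoint independent sets.
  Independence also holds when \<open>a = c\<close> or \<open>b = d\<close>, since there are no
  loops.\<close>

lemma ex_zeros_if_two_zeros:
  assumes "two_zeros (parcs G)"
  obtains f x y where "is_2RiDF G f" "x \<in> pverts G" "f x = 0" "y \<in> pverts G" "f y = 0" "x \<noteq> y"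
proof -
  from assms obtain x y a b c d where *: "(x, a) \<in> parcs G" "(x, b) \<in> parcs G"
      "(y, c) \<in> parcs G" "(y, d) \<in> parcs G" "x \<noteq> y" "{a, c} \<inter> {b, d} = {}"
      "(a, c) \<notin> parcs G" "(b, d) \<notin> parcs G"
    by (rule two_zerosE)
  have "independent_set G {a, c}" "independent_set G {b, d}" "{a, c} \<inter> {b, d} = {}"
    using * irrefl_arcs wellformed' arcs_symmetric by (auto simp: independent_set_def)
  then obtain f where f: "is_2RiDF G f" "f a = 1" "f b = 2" "f c = 1" "f d = 2"
    by (rule extend_to_2RiDF) auto
  show thesis
    using that[OF f(1) in_arcsD1[OF *(1)] zero_if_neighbors[OF f(1) *(1,2) f(2,3)]
        in_arcsD1[OF *(3)] zero_if_neighbors[OF f(1) *(3,4) f(4,5)] *(5)] .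
qed

lemma gamma_ri2_attained: obtains f where "is_2RiDF G f" "weight G f = gamma_ri2 G"
proof -
  obtain f where "is_2RiDF G f"
    by (rule extend_to_2RiDF[of "{}" "{}"]) (auto simp: independent_set_def)
  then have "\<exists>w f. is_2RiDF G f \<and> weight G f = w" by blast
  from LeastI_ex[OF this] show thesis using that unfolding gamma_ri2_def by blast
qed

lemma gamma_ri2_le: "is_2RiDF G f \<Longrightarrow> gamma_ri2 G \<le> weight G f"
  unfolding gamma_ri2_def by (rule Least_le) blast

text \<open>A function of minimum weight has the most zeros. So one function with a zero bounds the
  minimum from above, and one with two zeros would push it below the order minus one. The bound on
  the order keeps the subtraction from truncating.\<close>

lemma gamma_ri2_eq_iff:
  assumes "card (pverts G) \<ge> 2"
  shows "gamma_ri2 G = card (pverts G) - 1 \<longleftrightarrow> branching (parcs G) \<and> \<not> two_zeros (parcs G)"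
proof -
  let ?Z = "\<lambda>f. {v \<in> pverts G. f v = (0::nat)}"
  have fin: "finite (?Z f)" for f using pair_finite_verts by simp
  obtain f\<^sub>0 where f\<^sub>0: "is_2RiDF G f\<^sub>0" "weight G f\<^sub>0 = gamma_ri2 G"
    by (rule gamma_ri2_attained)
  show ?thesis
  proof (intro iffI conjI notI)
    assume gamma: "gamma_ri2 G = card (pverts G) - 1"
    then have "card (?Z f\<^sub>0) = 1" using weight_plus_zeros[of f\<^sub>0] f\<^sub>0 assms by simp
    then show "branching (parcs G)"
      using branching_if_zero[OF f\<^sub>0(1)] by (metis (mono_tags, lifting) card_1_singletonE insertI1 mem_Collect_eq)
    assume "two_zeros (parcs G)"
    then obtain f x y where f: "is_2RiDF G f" "x \<in> pverts G" "f x = 0" "y \<in> pverts G" "f y = 0" "x \<noteq> y"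
      by (rule ex_zeros_if_two_zeros)
    then have "card {x, y} \<le> card (?Z f)" by (intro card_mono fin) auto
    then show False
      using weight_plus_zeros[of f] gamma_ri2_le[OF f(1)] gamma assms \<open>x \<noteq> y\<close> by simp
  next
    assume *: "branching (parcs G) \<and> \<not> two_zeros (parcs G)"
    then obtain f x where f: "is_2RiDF G f" "x \<in> pverts G" "f x = 0"
      using ex_zero_if_branching by blast
    then have "card {x} \<le> card (?Z f)" by (intro card_mono fin) auto
    then have "gamma_ri2 G \<le> card (pverts G) - 1"
      using weight_plus_zeros[of f] gamma_ri2_le[OF f(1)] by simp
    moreover have "card (?Z f\<^sub>0) \<le> 1"
      using * two_zeros_if_zeros[OF f\<^sub>0(1)] fin by (auto simp: card_le_Suc0_iff_eq)
    ultimately show "gamma_ri2 G = card (pverts G) - 1"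
      using weight_plus_zeros[of f\<^sub>0] f\<^sub>0 assms by simp
  qed
qed

end

section \<open>Components and isomorphisms\<close>

text \<open>An explicit form of the component of \<open>v\<close>, to be matched below with the
  maximal connected subgraphs of \<open>connected_components\<close>. It is a pair digraph, so its
  arcs are pairs of vertices and \<open>parcs\<close> describes it completely.\<close>

definition component_of :: "'a pair_pre_digraph \<Rightarrow> 'a \<Rightarrow> 'a pair_pre_digraph" where
  "component_of G v = (let S = (parcs G)\<^sup>* `` {v} in \<lparr>pverts = S, parcs = parcs G \<inter> S \<times> S\<rparr>)"

lemma pverts_component_of: "pverts (component_of G v) = (parcs G)\<^sup>* `` {v}"
  by (simp add: component_of_def Let_def)

lemma parcs_component_of:
  "parcs (component_of G v) = parcs G \<inter> (parcs G)\<^sup>* `` {v} \<times> (parcs G)\<^sup>* `` {v}"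
  by (simp add: component_of_def Let_def)

context pair_graph
begin

lemma rtrancl_arcs_symmetric: "(u, v) \<in> (parcs G)\<^sup>* \<Longrightarrow> (v, u) \<in> (parcs G)\<^sup>*"
  by (rule symD[OF sym_rtrancl[OF symI]]) (rule arcs_symmetric)

lemma component_of_eq:
  assumes "(u, v) \<in> (parcs G)\<^sup>*"
  shows "component_of G u = component_of G v"
proof -
  have "(parcs G)\<^sup>* `` {u} \<subseteq> (parcs G)\<^sup>* `` {v}" if "(v, u) \<in> (parcs G)\<^sup>*" for u v
    using that by (auto intro: rtrancl_trans)
  then have "(parcs G)\<^sup>* `` {u} = (parcs G)\<^sup>* `` {v}"
    using assms rtrancl_arcs_symmetric[OF assms] by (intro equalityI)
  then show ?thesis by (simp add: component_of_def)
qed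

lemma component_of_subset: "v \<in> pverts G \<Longrightarrow> (parcs G)\<^sup>* `` {v} \<subseteq> pverts G"
proof
  fix u assume "v \<in> pverts G" "u \<in> (parcs G)\<^sup>* `` {v}"
  then show "u \<in> pverts G" by (cases "u = v") (auto dest: rtranclD tranclD2 in_arcsD2)
qed

lemma pair_graph_component_of:
  assumes "v \<in> pverts G"
  shows "pair_graph (component_of G v)"
proof -
  have "finite (parcs G \<inter> (parcs G)\<^sup>* `` {v} \<times> (parcs G)\<^sup>* `` {v})"
    using pair_finite_arcs by blast
  moreover have "finite ((parcs G)\<^sup>* `` {v})"
    using component_of_subset[OF assms] pair_finite_verts by (rule finite_subset)
  moreover have "symmetric (component_of G v)"
    using arcs_symmetric by (auto simp: symmetric_def sym_def parcs_component_of)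
  ultimately show ?thesis
    using irrefl_arcs by unfold_locales (auto simp: pverts_component_of parcs_component_of)
qed

text \<open>Connectedness of \<open>H\<close> only gives paths in the symmetric closure of its arcs,
  and \<open>H\<close> itself may fail to be symmetric; but \<open>G\<close> is symmetric, so these
  paths run in \<open>G\<close>.\<close>

lemma subgraph_connected_rtrancl:
  assumes "subgraph H G" "connected H" "u \<in> verts H" "v \<in> verts H"
  shows "(u, v) \<in> (parcs G)\<^sup>*"
proof -
  have "(u, v) \<in> rtrancl_on (verts H) ((arcs_ends H)\<^sup>s)"
    using assms(2-) unfolding connected_conv by blast
  then have reach: "(u, v) \<in> ((arcs_ends H)\<^sup>s)\<^sup>*" by (rule rtrancl_on_rtranclI)
  have "arcs_ends H \<subseteq> parcs G"
    using assms(1) by (auto simp: subgraph_def compatible_def arcs_ends_def arc_to_ends_def)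
  then have "(arcs_ends H)\<^sup>s \<subseteq> parcs G"
    using arcs_symmetric by (auto simp: symcl_def)
  from subsetD[OF rtrancl_mono[OF this] reach] show ?thesis .
qed

lemma subgraph_connected_component_of:
  assumes "subgraph H G" "connected H" "v \<in> verts H"
  shows "subgraph H (component_of G v)"
proof -
  have "v \<in> pverts G" using assms(1,3) by (auto simp: subgraph_def)
  then interpret C: pair_graph "component_of G v" by (rule pair_graph_component_of)
  interpret H: wf_digraph H using assms(1) by (simp add: subgraph_def)
  have verts: "verts H \<subseteq> (parcs G)\<^sup>* `` {v}"
    using subgraph_connected_rtrancl[OF assms(1,2)] assms(3) by blast
  have H: "arcs H \<subseteq> parcs G" "tail H = fst" "head H = snd"
    using assms(1) by (auto simp: subgraph_def compatible_def)
  have "e \<in> parcs (component_of G v)" if "e \<in> arcs H" for e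
  proof -
    have "fst e \<in> verts H" "snd e \<in> verts H" using H.wellformed[OF that] H by auto
    then show ?thesis using H(1) that verts by (cases e) (auto simp: parcs_component_of)
  qed
  with verts H show ?thesis
    using H.wf_digraph C.wf_digraph by (auto simp: subgraph_def compatible_def pverts_component_of)
qed

lemma component_of_in_connected_components:
  assumes "v \<in> pverts G"
  shows "with_proj (component_of G v) \<in> connected_components G"
proof -
  let ?S = "(parcs G)\<^sup>* `` {v}" and ?C = "component_of G v"
  interpret C: pair_graph ?C by (rule pair_graph_component_of[OF assms])
  have sub: "subgraph ?C G"
    using component_of_subset[OF assms] C.wf_digraph wf_digraph
    by (auto simp: subgraph_def pverts_component_of parcs_component_of)
  have "(v, u) \<in> (parcs ?C)\<^sup>*" if "(v, u) \<in> (parcs G)\<^sup>*" for u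
    using that
  proof (induction rule: rtrancl_induct)
    case (step y z)
    then have "(y, z) \<in> parcs ?C"
      by (auto simp: parcs_component_of intro: rtrancl_into_rtrancl)
    with step.IH show ?case by (rule rtrancl_into_rtrancl)
  qed simp
  then have "(u, w) \<in> (parcs ?C)\<^sup>*" if "u \<in> ?S" "w \<in> ?S" for u w
    using that by (blast intro: C.rtrancl_arcs_symmetric rtrancl_trans)
  then have "strongly_connected ?C"
    by (auto simp: strongly_connected_def C.reachable_conv pverts_component_of)
  then have "connected ?C"
    by (intro C.connectedI) (auto simp: strongly_connected_def intro: C.reachable_mk_symmetricI)
  \<comment> \<open>A connected \<open>H\<close> between the component and \<open>G\<close> contains
    \<open>v\<close>, so it lies inside the component again and equals it.\<close>
  moreover have "\<not> connected H" if "with_proj ?C \<noteq> H" "subgraph ?C H" "subgraph H G" for H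
  proof
    assume "connected H"
    moreover have "v \<in> verts H"
      using that(2) by (auto simp: subgraph_def pverts_component_of)
    ultimately have "subgraph H ?C" using that(3) by (intro subgraph_connected_component_of)
    then have "with_proj ?C = H"
      using that(2) by (intro pre_digraph.equality) (auto simp: subgraph_def compatible_def)
    with that(1) show False ..
  qed
  ultimately show ?thesis
    unfolding connected_components_def using sub by (auto intro: max_subgraphI)
qed

text \<open>A connected graph is nonempty, so a maximal connected \<open>H\<close> contains some
  \<open>v\<close> and lies in the component of \<open>v\<close>; maximality makes the two
  equal.\<close>

lemma connected_components_eq:
  "connected_components G = (\<lambda>v. with_proj (component_of G v)) ` pverts G"
proof (intro equalityI subsetI)
  fix H assume H: "H \<in> connected_components G"
  then have *: "max_subgraph connected H" by (simp add: connected_components_def)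
  then have "connected H" "subgraph H G" by (auto simp: max_subgraph_def)
  moreover then obtain v where v: "v \<in> verts H" by (auto simp: connected_conv)
  ultimately have "subgraph H (component_of G v)"
    by (intro subgraph_connected_component_of)
  moreover have "v \<in> pverts G" using v \<open>subgraph H G\<close> by (auto simp: subgraph_def)
  moreover then have "max_subgraph connected (component_of G v)"
    using component_of_in_connected_components by (simp add: connected_components_def)
  ultimately show "H \<in> (\<lambda>v. with_proj (component_of G v)) ` pverts G"
    using max_subgraph_subg_eq[OF *] by blast
qed (use component_of_in_connected_components in blast)

end

section \<open>Isomorphisms of pair digraphs as vertex maps\<close>

lemma with_proj_eq_iff: "with_proj H = with_proj H' \<longleftrightarrow> H = H'"
  by (cases H, cases H') (auto simp: with_proj_def)

text \<open>\<open>digraph_iso\<close> carries separate maps for vertices and arcs. Arcs of the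
  target are pairs of their ends, so the vertex map determines the arc map, which must be
  \<open>map_prod f f\<close>.\<close>

lemma digraph_iso_with_proj_iff:
  "digraph_iso (with_proj G) (with_proj H) \<longleftrightarrow> pair_wf_digraph G \<and>
     (\<exists>f. inj_on f (pverts G) \<and> pverts H = f ` pverts G \<and> parcs H = map_prod f f ` parcs G)"
  (is "?L \<longleftrightarrow> ?R")
proof
  assume ?L
  then obtain h where h: "pre_digraph.digraph_isomorphism G h" "with_proj H = app_iso h G"
    unfolding digraph_iso_def by blast
  have ends: "iso_tail h = fst" "iso_head h = snd" "pverts H = iso_verts h ` pverts G"
      "parcs H = iso_arcs h ` parcs G"
    using h(2) by (auto simp: with_proj_def app_iso_def)
  have "iso_arcs h a = map_prod (iso_verts h) (iso_verts h) a" if "a \<in> parcs G" for a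
    using h(1) that ends by (cases "iso_arcs h a") (auto simp: pre_digraph.digraph_isomorphism_def map_prod_def split: prod.split)
  then have "parcs H = map_prod (iso_verts h) (iso_verts h) ` parcs G"
    using ends(4) by auto
  then show ?R
    using h(1) ends(3) by (auto simp: pre_digraph.digraph_isomorphism_def wf_digraph_wp_iff)
next
  assume ?R
  then obtain f where wf: "pair_wf_digraph G" and f: "inj_on f (pverts G)" "pverts H = f ` pverts G"
      "parcs H = map_prod f f ` parcs G" by blast
  interpret pair_wf_digraph G by (rule wf)
  let ?h = "\<lparr>iso_verts = f, iso_arcs = map_prod f f, iso_head = snd, iso_tail = fst\<rparr>"
  have "parcs G \<subseteq> pverts G \<times> pverts G" using wellformed' by auto
  then have "inj_on (map_prod f f) (parcs G)"
    using map_prod_inj_on[OF f(1) f(1)] by (rule inj_on_subset[rotated])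
  then have "pre_digraph.digraph_isomorphism G ?h"
    using f(1) wf by (auto simp: pre_digraph.digraph_isomorphism_def wf_digraph_wp_iff)
  moreover have "with_proj H = app_iso ?h G"
    using f by (simp add: with_proj_def app_iso_def)
  ultimately show ?L unfolding digraph_iso_def by blast
qed

text \<open>The required non-arcs and inequalities survive because \<open>f\<close> is injective on
  a set containing all ends of arcs, so it reflects arcs as well as equality.\<close>

lemma two_zeros_map_prod:
  assumes "two_zeros E" "inj_on f V" "E \<subseteq> V \<times> V"
  shows "two_zeros (map_prod f f ` E)"
proof -
  from assms(1) obtain x y a b c d where *: "(x, a) \<in> E" "(x, b) \<in> E" "(y, c) \<in> E" "(y, d) \<in> E"
      "x \<noteq> y" "{x, y} \<inter> {a, b, c, d} = {}" "{a, c} \<inter> {b, d} = {}" "(a, c) \<notin> E" "(b, d) \<notin> E"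
    by (rule two_zerosE)
  have arc: "(f u, f v) \<in> map_prod f f ` E \<longleftrightarrow> (u, v) \<in> E" if "u \<in> V" "v \<in> V" for u v
  proof
    assume "(f u, f v) \<in> map_prod f f ` E"
    then obtain u' v' where uv: "(u', v') \<in> E" "f u = f u'" "f v = f v'" by auto
    then have "u' \<in> V" "v' \<in> V" using assms(3) by auto
    with uv that assms(2) show "(u, v) \<in> E" by (metis inj_onD)
  qed force
  have V: "x \<in> V" "y \<in> V" "a \<in> V" "b \<in> V" "c \<in> V" "d \<in> V" using * assms(3) by auto
  have eq: "f u = f v \<longleftrightarrow> u = v" if "u \<in> V" "v \<in> V" for u v
    using that assms(2) by (auto dest: inj_onD)
  show ?thesis
  proof (rule two_zerosI)
    show "(f x, f a) \<in> map_prod f f ` E" "(f x, f b) \<in> map_prod f f ` E"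
      "(f y, f c) \<in> map_prod f f ` E" "(f y, f d) \<in> map_prod f f ` E"
      using *(1-4) by (auto simp: arc V)
    show "(f a, f c) \<notin> map_prod f f ` E" "(f b, f d) \<notin> map_prod f f ` E"
      using *(8,9) by (simp_all add: arc V)
  qed (use *(5-7) in \<open>simp_all add: eq V\<close>)
qed

lemma branching_map_prod:
  assumes "branching (map_prod f f ` E)" "inj_on f V" "E \<subseteq> V \<times> V"
  shows "branching E"
proof -
  from assms(1) obtain x a y b where *: "(x, a) \<in> E" "(y, b) \<in> E" "f x = f y" "f a \<noteq> f b"
    unfolding branching_def by auto
  then have "x \<in> V" "y \<in> V" using assms(3) by auto
  then have "x = y" using *(3) assms(2) by (metis inj_onD)
  with * show ?thesis unfolding branching_def by metis
qed

section \<open>Graphs with at most one zero\<close>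

lemma rtrancl_Image_singleton_eqI:
  assumes "c \<in> T" "E `` T \<subseteq> T" "T \<subseteq> E\<^sup>* `` {c}"
  shows "E\<^sup>* `` {c} = T"
proof -
  have "E\<^sup>* `` {c} \<subseteq> E\<^sup>* `` T" using assms(1) by blast
  also have "\<dots> = T" using assms(2) by (rule Image_closed_trancl)
  finally show ?thesis using assms(3) by blast
qed

lemma card_three_avoid_two:
  assumes "3 \<le> card A"
  obtains u where "u \<in> A" "u \<noteq> a" "u \<noteq> b"
proof -
  have "\<not> A \<subseteq> {a, b}"
  proof
    assume "A \<subseteq> {a, b}"
    then have "card A \<le> card {a, b}" by (intro card_mono) auto
    also have "\<dots> \<le> 2" by (simp add: card_insert_if)
    finally show False using assms by simp
  qed
  with that show thesis by blast
qed

locale at_most_one_zero =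
  fixes E :: "'a rel"
  assumes arc_sym: "(x, y) \<in> E \<Longrightarrow> (y, x) \<in> E"
    and arc_irrefl: "(x, x) \<notin> E"
    and no_two_zeros: "\<not> two_zeros E"
begin

text \<open>Otherwise \<open>x\<close> and \<open>y\<close> could both receive 0, with
  \<open>a\<close> and \<open>b\<close> as their shared neighbours of value 1 and 2.\<close>

lemma no_4_cycle:
  assumes "(x, a) \<in> E" "(a, y) \<in> E" "(y, b) \<in> E" "(b, x) \<in> E" "x \<noteq> y"
  shows "a = b"
proof (rule ccontr)
  assume "a \<noteq> b"
  then have "two_zeros E"
    using assms arc_sym arc_irrefl by (intro two_zerosI[of x a E b y a b]) auto
  then show False using no_two_zeros by blast
qed

text \<open>Chords are not excluded here; \<open>cycle5_neighbors\<close> shows that there are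
  none.\<close>

definition cycle5 :: "'a \<Rightarrow> 'a \<Rightarrow> 'a \<Rightarrow> 'a \<Rightarrow> 'a \<Rightarrow> bool" where
  "cycle5 p q r s t \<longleftrightarrow> distinct [p, q, r, s, t] \<and>
     (p, q) \<in> E \<and> (q, r) \<in> E \<and> (r, s) \<in> E \<and> (s, t) \<in> E \<and> (t, p) \<in> E"

text \<open>Put 0 on \<open>q\<close> and \<open>s\<close>, 1 on \<open>r\<close>, and 2 on
  \<open>p\<close> and \<open>t\<close>: only an edge between \<open>p\<close> and \<open>t\<close>
  can prevent this.\<close>

lemma path5_imp_cycle5:
  assumes "distinct [p, q, r, s, t]" "(p, q) \<in> E" "(q, r) \<in> E" "(r, s) \<in> E" "(s, t) \<in> E"
  shows "cycle5 p q r s t"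
proof -
  have "(p, t) \<in> E"
  proof (rule ccontr)
    assume "(p, t) \<notin> E"
    then have "two_zeros E"
      using assms arc_sym[OF assms(2)] arc_sym[OF assms(4)] arc_irrefl
      by (intro two_zerosI[of q r E p s r t]) auto
    then show False using no_two_zeros by blast
  qed
  then show ?thesis using assms arc_sym unfolding cycle5_def by blast
qed

lemma cycle5_rotate: "cycle5 p q r s t \<Longrightarrow> cycle5 q r s t p"
  unfolding cycle5_def by auto

text \<open>A chord from \<open>p\<close> to \<open>r\<close> or \<open>s\<close> closes a 4-cycle.
  A neighbour \<open>v\<close> outside the cycle starts the path \<open>v\<close>, \<open>p\<close>,
  \<open>q\<close>, \<open>r\<close>, \<open>s\<close>, whose ends are then adjacent, and
  \<open>p\<close>, \<open>v\<close>, \<open>s\<close>, \<open>t\<close> is a 4-cycle.\<close>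

lemma cycle5_neighbors:
  assumes "cycle5 p q r s t"
  shows "E `` {p} = {q, t}"
proof -
  have e: "(p, q) \<in> E" "(q, r) \<in> E" "(r, s) \<in> E" "(s, t) \<in> E" "(t, p) \<in> E"
    and d: "distinct [p, q, r, s, t]"
    using assms by (auto simp: cycle5_def)
  have "v \<in> {q, t}" if v: "(p, v) \<in> E" for v
  proof (rule ccontr)
    assume new: "v \<notin> {q, t}"
    have "v \<noteq> p" using v arc_irrefl by blast
    have "v \<noteq> r" using no_4_cycle[OF v _ e(4,5)] e(3) d by auto
    have "v \<noteq> s" using no_4_cycle[OF v arc_sym _ arc_sym[OF e(1)], of r] e(2,3) d arc_sym by auto
    then have "cycle5 v p q r s"
      using new v e d \<open>v \<noteq> p\<close> \<open>v \<noteq> r\<close> arc_sym by (intro path5_imp_cycle5) auto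
    then have "(v, s) \<in> E" using arc_sym unfolding cycle5_def by blast
    from no_4_cycle[OF v this e(4,5)] show False using d new by auto
  qed
  then show ?thesis using e arc_sym by blast
qed

text \<open>Rotation turns the neighbourhood of \<open>p\<close> into those of all five vertices, so
  the cycle is closed under adjacency. The arcs are listed in the order of
  \<open>parcs_cycle_graph_5\<close>.\<close>

lemma cycle5_component:
  assumes "cycle5 p q r s t"
  shows "E\<^sup>* `` {p} = {p, q, r, s, t}"
    and "E \<inter> {p, q, r, s, t} \<times> {p, q, r, s, t} =
      {(p, q), (q, r), (r, s), (s, t), (t, p), (q, p), (r, q), (s, r), (t, s), (p, t)}"
proof -
  note c1 = assms and c2 = cycle5_rotate[OF assms]
  note c3 = cycle5_rotate[OF c2] note c4 = cycle5_rotate[OF c3] note c5 = cycle5_rotate[OF c4]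
  note N = cycle5_neighbors[OF c1] cycle5_neighbors[OF c2] cycle5_neighbors[OF c3]
    cycle5_neighbors[OF c4] cycle5_neighbors[OF c5]
  have "E `` {p, q, r, s, t} = E `` {p} \<union> E `` {q} \<union> E `` {r} \<union> E `` {s} \<union> E `` {t}" by blast
  then have closed: "E `` {p, q, r, s, t} \<subseteq> {p, q, r, s, t}" unfolding N by auto
  have e: "(p, q) \<in> E" "(q, r) \<in> E" "(r, s) \<in> E" "(s, t) \<in> E"
    using assms by (auto simp: cycle5_def)
  have "(p, q) \<in> E\<^sup>*" "(p, r) \<in> E\<^sup>*" "(p, s) \<in> E\<^sup>*" "(p, t) \<in> E\<^sup>*"
    using e by (meson r_into_rtrancl rtrancl_into_rtrancl)+
  with closed show "E\<^sup>* `` {p} = {p, q, r, s, t}"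
    by (intro rtrancl_Image_singleton_eqI) auto
  have "E \<inter> {p, q, r, s, t} \<times> {p, q, r, s, t} =
      {p} \<times> E `` {p} \<union> {q} \<times> E `` {q} \<union> {r} \<times> E `` {r} \<union> {s} \<times> E `` {s} \<union> {t} \<times> E `` {t}"
    using closed by blast
  then show "E \<inter> {p, q, r, s, t} \<times> {p, q, r, s, t} =
      {(p, q), (q, r), (r, s), (s, t), (t, p), (q, p), (r, q), (s, r), (t, s), (p, t)}"
    unfolding N by auto
qed

lemma component_without_cycle5:
  assumes finite: "finite E" and no_cycle: "\<And>p q r s t. \<not> cycle5 p q r s t"
    and max: "\<And>x. card (E `` {x}) \<le> card (E `` {c})" and deg: "2 \<le> card (E `` {c})"
  defines "S \<equiv> E\<^sup>* `` {c}"
  obtains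
    (star) L where "S = insert c L" "c \<notin> L" "2 \<le> card L"
      "E \<inter> S \<times> S = {c} \<times> L \<union> L \<times> {c}"
  | (star_plus) L p q where "S = insert c L" "c \<notin> L" "p \<in> L" "q \<in> L" "p \<noteq> q"
      "E \<inter> S \<times> S = {c} \<times> L \<union> L \<times> {c} \<union> {(p, q), (q, p)}"
  | (double_star) L v w where "S = L \<union> {c, v, w}" "distinct [c, v, w]" "L \<inter> {c, v, w} = {}" "1 \<le> card L"
      "E \<inter> S \<times> S = {c} \<times> L \<union> L \<times> {c} \<union> {(c, v), (v, c), (v, w), (w, v)}"
proof -
  \<comment> \<open>Without 5-cycles, no path on five vertices exists at all; most cases below are
    refuted by exhibiting one.\<close>
  have no_path: "\<not> ((p, q) \<in> E \<and> (q, r) \<in> E \<and> (r, s) \<in> E \<and> (s, t) \<in> E)"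
    if "distinct [p, q, r, s, t]" for p q r s t
    using path5_imp_cycle5[OF that] no_cycle by blast
  define N where "N = E `` {c}"
  have N: "(c, x) \<in> E \<longleftrightarrow> x \<in> N" "(x, c) \<in> E \<longleftrightarrow> x \<in> N" for x
    using arc_sym by (auto simp: N_def)
  have "c \<notin> N" using N arc_irrefl by blast
  have "finite N" using finite unfolding N_def by (rule finite_Image)
  \<comment> \<open>By maximality of \<open>c\<close>, a vertex with three neighbours anywhere
    forces three at \<open>c\<close>; this supplies further neighbours of \<open>c\<close>
    below.\<close>
  have degree3: "3 \<le> card N" if "{x, y, z} \<subseteq> E `` {u}" "distinct [x, y, z]" for u x y z
  proof -
    have "card {x, y, z} = 3" using that(2) by simp
    moreover have "card {x, y, z} \<le> card (E `` {u})"
      using that(1) finite by (intro card_mono finite_Image)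
    ultimately show ?thesis using max[of u] by (simp add: N_def)
  qed
  show thesis
  proof (cases "E `` N \<subseteq> insert c N")
    case True
    then have S: "S = insert c N"
      unfolding S_def using N by (intro rtrancl_Image_singleton_eqI) auto
    \<comment> \<open>At most one edge lies inside \<open>N\<close>: two disjoint edges are joined
      through \<open>c\<close> to a path on five vertices, and two edges sharing one vertex form a
      path that \<open>c\<close> closes to a 4-cycle.\<close>
    have unique: "{x, y} = {x', y'}"
      if xy: "x \<in> N" "y \<in> N" "(x, y) \<in> E" and xy': "x' \<in> N" "y' \<in> N" "(x', y') \<in> E" for x y x' y'
    proof (rule ccontr)
      assume neq: "{x, y} \<noteq> {x', y'}"
      have path3: False if "u \<in> N" "v \<in> N" "w \<in> N" "(u, v) \<in> E" "(v, w) \<in> E" "u \<noteq> w" for u v w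
        using no_4_cycle[of u v w c] that N \<open>c \<notin> N\<close> by blast
      have "distinct [x, y]" "distinct [x', y']" using xy xy' arc_irrefl by auto
      show False
      proof (cases "{x, y} \<inter> {x', y'} = {}")
        case True
        then show False
          using no_path[of x y c x' y'] xy xy' N \<open>c \<notin> N\<close> \<open>distinct [x, y]\<close> \<open>distinct [x', y']\<close> by auto
      next
        case False
        then show False
          using neq path3[of y x y'] path3[of y x x'] path3[of x y y'] path3[of x y x']
            xy xy' arc_sym[OF xy(3)] arc_sym[OF xy'(3)]
          by auto
      qed
    qed
    have SS: "E \<inter> S \<times> S = {c} \<times> N \<union> N \<times> {c} \<union> E \<inter> N \<times> N"
      unfolding S using N arc_irrefl by auto
    show thesis
    proof (cases "E \<inter> N \<times> N = {}")
      case True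
      with SS S \<open>c \<notin> N\<close> deg star[of N] show thesis by (simp add: N_def)
    next
      case False
      then obtain p q where pq: "p \<in> N" "q \<in> N" "(p, q) \<in> E" by auto
      then have "p \<noteq> q" using arc_irrefl by blast
      have "E \<inter> N \<times> N = {(p, q), (q, p)}"
      proof (intro equalityI subsetI)
        fix e assume "e \<in> E \<inter> N \<times> N"
        then obtain x y where "e = (x, y)" "x \<in> N" "y \<in> N" "(x, y) \<in> E" by auto
        then show "e \<in> {(p, q), (q, p)}"
          using unique[OF pq, of x y] arc_irrefl by (auto simp: doubleton_eq_iff)
      qed (use pq arc_sym in auto)
      with SS S \<open>c \<notin> N\<close> pq \<open>p \<noteq> q\<close> star_plus[of N p q] show thesis by simp
    qed
  next
    case False
    \<comment> \<open>\<open>w\<close> is at distance two from \<open>c\<close>, with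
      \<open>v\<close> in between. The remaining neighbours of \<open>c\<close>, collected in
      \<open>L\<close>, will turn out to be leaves.\<close>
    then obtain v w where vw: "v \<in> N" "(v, w) \<in> E" "w \<noteq> c" "w \<notin> N" by auto
    then have dist: "distinct [c, v, w]" using \<open>c \<notin> N\<close> by auto
    define L where "L = N - {v}"
    have "1 \<le> card L" using deg vw(1) \<open>finite N\<close> unfolding L_def N_def[symmetric] by simp
    have "w \<notin> L" "v \<notin> L" "c \<notin> L" using vw \<open>c \<notin> N\<close> by (auto simp: L_def)
    \<comment> \<open>Otherwise \<open>v\<close> has the neighbours \<open>c\<close>,
      \<open>u\<close>, \<open>w\<close>, so \<open>c\<close> has a neighbour \<open>u'\<close>
      besides \<open>u\<close> and \<open>v\<close>, and \<open>u'\<close>, \<open>c\<close>,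
      \<open>u\<close>, \<open>v\<close>, \<open>w\<close> is a path.\<close>
    have u_not_v: "(u, v) \<notin> E" if u: "u \<in> L" for u
    proof
      assume uv: "(u, v) \<in> E"
      have "3 \<le> card N"
        using uv vw N arc_sym u \<open>c \<notin> N\<close> by (intro degree3[of c u w v]) (auto simp: L_def)
      then obtain u' where "u' \<in> N" "u' \<noteq> u" "u' \<noteq> v" by (rule card_three_avoid_two)
      then show False
        using no_path[of u' c u v w] uv vw N u \<open>c \<notin> N\<close> by (auto simp: L_def)
    qed
    \<comment> \<open>The choice \<open>x = w\<close> would close the 4-cycle \<open>c\<close>,
      \<open>u\<close>, \<open>w\<close>, \<open>v\<close>; any other \<open>x\<close> would give
      the path \<open>x\<close>, \<open>u\<close>, \<open>c\<close>, \<open>v\<close>,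
      \<open>w\<close>.\<close>
    have u_neighbors: "x = c" if u: "u \<in> L" and ux: "(u, x) \<in> E" for u x
    proof (rule ccontr)
      assume "x \<noteq> c"
      have "x \<noteq> v" using u_not_v[OF u] ux by blast
      moreover have "x \<noteq> u" using ux arc_irrefl by blast
      moreover have "x \<noteq> w"
      proof
        assume "x = w"
        then have "u = v" using no_4_cycle[of c u w v] ux u vw N arc_sym by (auto simp: L_def)
        then show False using \<open>v \<notin> L\<close> u by blast
      qed
      ultimately show False
        using no_path[of x u c v w] arc_sym[OF ux] u vw N \<open>x \<noteq> c\<close> \<open>c \<notin> N\<close> by (auto simp: L_def)
    qed
    obtain u\<^sub>0 where u\<^sub>0: "u\<^sub>0 \<in> L" using \<open>1 \<le> card L\<close> by fastforce
    have w_neighbors: "x = v" if wx: "(w, x) \<in> E" for x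
    proof (rule ccontr)
      assume "x \<noteq> v"
      have "x \<noteq> u\<^sub>0" using u_neighbors[OF u\<^sub>0 arc_sym] wx vw(3) by blast
      moreover have "x \<noteq> c" using wx N vw by blast
      moreover have "x \<noteq> w" using wx arc_irrefl by blast
      ultimately show False
        using no_path[of u\<^sub>0 c v w x] wx vw N u\<^sub>0 \<open>x \<noteq> v\<close> \<open>c \<notin> N\<close> by (auto simp: L_def)
    qed
    \<comment> \<open>A third neighbour \<open>x\<close> of \<open>v\<close> forces a second leaf
      \<open>u'\<close> at \<open>c\<close>. Then \<open>c\<close> and \<open>v\<close> can both
      receive 0: \<open>u\<^sub>0\<close> and \<open>w\<close> get 1, \<open>u'\<close> and
      \<open>x\<close> get 2, and the required non-arcs hold because the only neighbour of
      \<open>u\<^sub>0\<close> and of \<open>u'\<close> is \<open>c\<close>.\<close>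
    have v_neighbors: "x = c \<or> x = w" if vx: "(v, x) \<in> E" for x
    proof (rule ccontr)
      assume x: "\<not> (x = c \<or> x = w)"
      have "x \<notin> L" using u_not_v arc_sym[OF vx] by blast
      have "x \<noteq> v" using vx arc_irrefl by blast
      have "3 \<le> card N"
        using vw vx x N by (intro degree3[of c w x v]) auto
      then obtain u' where u': "u' \<in> N" "u' \<noteq> u\<^sub>0" "u' \<noteq> v" by (rule card_three_avoid_two)
      then have "u' \<in> L" by (simp add: L_def)
      have "(u\<^sub>0, w) \<notin> E" "(u', x) \<notin> E"
        using u_neighbors[OF u\<^sub>0] u_neighbors[OF \<open>u' \<in> L\<close>] x vw by auto
      then have "two_zeros E"
        using vw vx u' u\<^sub>0 x N \<open>x \<notin> L\<close> \<open>u' \<in> L\<close> \<open>x \<noteq> v\<close> \<open>c \<notin> N\<close> dist \<open>w \<notin> L\<close>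
        by (intro two_zerosI[of c u\<^sub>0 E u' v w x]) (auto simp: L_def)
      then show False using no_two_zeros by blast
    qed
    have c_neighbors: "x \<in> L \<or> x = v" if "(c, x) \<in> E" for x
      using that N by (auto simp: L_def)
    have "(c, v) \<in> E\<^sup>*" using vw(1) N by blast
    then have "w \<in> E\<^sup>* `` {c}" using vw(2) by (auto intro: rtrancl_into_rtrancl)
    moreover have "N \<subseteq> E\<^sup>* `` {c}" using N by auto
    ultimately have "L \<union> {c, v, w} \<subseteq> E\<^sup>* `` {c}" using vw(1) by (auto simp: L_def)
    moreover have "E `` (L \<union> {c, v, w}) \<subseteq> L \<union> {c, v, w}"
      by (auto dest: u_neighbors w_neighbors v_neighbors c_neighbors)
    ultimately have S: "S = L \<union> {c, v, w}"
      unfolding S_def by (intro rtrancl_Image_singleton_eqI) auto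
    have arcs: "(c, v) \<in> E" "(v, c) \<in> E" "(v, w) \<in> E" "(w, v) \<in> E"
        "{c} \<times> L \<union> L \<times> {c} \<subseteq> E"
      using vw N arc_sym by (auto simp: L_def)
    have "E \<inter> S \<times> S = {c} \<times> L \<union> L \<times> {c} \<union> {(c, v), (v, c), (v, w), (w, v)}"
    proof (intro equalityI subsetI)
      fix e assume e: "e \<in> E \<inter> S \<times> S"
      then obtain x y where "e = (x, y)" "(x, y) \<in> E" "x \<in> L \<union> {c, v, w}" using S by auto
      then show "e \<in> {c} \<times> L \<union> L \<times> {c} \<union> {(c, v), (v, c), (v, w), (w, v)}"
        by (auto dest: u_neighbors w_neighbors v_neighbors c_neighbors)
    qed (use arcs S in auto)
    then show thesis
      using double_star[of L v w] S dist \<open>1 \<le> card L\<close> \<open>w \<notin> L\<close> \<open>v \<notin> L\<close> \<open>c \<notin> L\<close> by auto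
  qed
qed

end

section \<open>The extremal graphs\<close>

text \<open>This and the next three lemmas bring the arc sets into the shape in which
  \<open>component_without_cycle5\<close> and \<open>cycle5_component\<close> describe components,
  so that images of arcs can be compared term by term.\<close>

lemma parcs_star: "parcs (star m) = {0} \<times> {1..m} \<union> {1..m} \<times> {0}"
  by (auto simp: star_def star_edges_def undirected_def)

lemma parcs_star_plus:
  "parcs (star_plus m) = {0} \<times> {1..m} \<union> {1..m} \<times> {0} \<union> {(1, 2), (2, 1)}"
  by (auto simp: star_plus_def star_edges_def undirected_def)

lemma parcs_double_star_1:
  "parcs (double_star m 1) = {Inl 0} \<times> Inl ` {1..m} \<union> Inl ` {1..m} \<times> {Inl 0} \<union>
     {(Inl 0, Inr 0), (Inr 0, Inl 0), (Inr 0, Inr 1), (Inr 1, Inr 0)}"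
  by (auto simp: double_star_def undirected_def)

lemma parcs_cycle_graph_5:
  "parcs (cycle_graph 5) =
     {(0, 1), (1, 2), (2, 3), (3, 4), (4, 0), (1, 0), (2, 1), (3, 2), (4, 3), (0, 4)}"
proof -
  let ?E = "{(0, 1), (1, 2), (2, 3), (3, 4), (4, 0)} :: nat rel"
  have "{(i, Suc i mod 5) | i. i < 5} = (\<lambda>i. (i, Suc i mod 5)) ` {..<5}" by auto
  also have "{..<5::nat} = {0, 1, 2, 3, 4}" by auto
  also have "(\<lambda>i. (i, Suc i mod 5)) ` {0, 1, 2, 3, 4} = ?E" by (simp add: numeral_2_eq_2)
  finally have "parcs (cycle_graph 5) = ?E \<union> ?E\<inverse>"
    by (simp add: cycle_graph_def undirected_def)
  moreover have "?E\<inverse> = {(1, 0), (2, 1), (3, 2), (4, 3), (0, 4)}" by auto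
  ultimately show ?thesis by simp
qed

lemma pverts_concrete:
  "pverts (star m) = {0..m}" "pverts (star_plus m) = {0..m}"
  "pverts (double_star m 1) = Inl ` {0..m} \<union> {Inr 0, Inr 1}"
  "pverts (cycle_graph 5) = {0, 1, 2, 3, 4}"
  by (auto simp: star_def star_plus_def double_star_def cycle_graph_def undirected_def)

section \<open>Isomorphisms onto the four families\<close>

lemma digraph_isoI:
  assumes "parcs H \<subseteq> pverts H \<times> pverts H" "inj_on f (pverts H)"
    "f ` pverts H = pverts K" "map_prod f f ` parcs H = parcs K"
  shows "digraph_iso (with_proj H) (with_proj K)"
proof -
  have "pair_wf_digraph H" using assms(1) by unfold_locales auto
  with assms(2-) show ?thesis unfolding digraph_iso_with_proj_iff by metis
qed

lemma map_prod_image_Times: "map_prod f g ` (A \<times> B) = f ` A \<times> g ` B"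
  by auto

lemma digraph_iso_star:
  fixes H :: "'a pair_pre_digraph"
  assumes "finite L" "c \<notin> L" "pverts H = insert c L" "parcs H = {c} \<times> L \<union> L \<times> {c}"
  shows "digraph_iso H (star (card L))"
proof -
  obtain h where h: "bij_betw h L {1..card L}"
    using finite_same_card_bij[OF assms(1), of "{1..card L}"] by auto
  define f where "f = h(c := 0)"
  have "f ` L = h ` L" using assms(2) by (auto simp: f_def)
  then have f: "f c = 0" "f ` L = {1..card L}" using h by (auto simp: f_def bij_betw_def)
  have "inj_on f L"
    using h assms(2) by (auto simp: f_def bij_betw_def inj_on_def)
  then have "inj_on f (insert c L)" using f assms(2) by auto
  moreover have "f ` insert c L = {0..card L}" using f by auto
  moreover have "map_prod f f ` parcs H = parcs (star (card L))"
    unfolding assms parcs_star image_Un map_prod_image_Times by (simp add: f)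
  ultimately show ?thesis
    using assms by (intro digraph_isoI[of _ f]) (auto simp: pverts_concrete)
qed

lemma digraph_iso_star_plus:
  fixes H :: "'a pair_pre_digraph"
  assumes "finite L" "c \<notin> L" "p \<in> L" "q \<in> L" "p \<noteq> q" "pverts H = insert c L"
    "parcs H = {c} \<times> L \<union> L \<times> {c} \<union> {(p, q), (q, p)}"
  shows "digraph_iso H (star_plus (card L))"
proof -
  let ?m = "card L"
  have "card {p, q} \<le> ?m" using assms(1,3,4) by (intro card_mono) auto
  then have m: "?m = card (L - {p, q}) + 2"
    using assms(1,3-5) by (simp add: card_Diff_subset)
  \<comment> \<open>The added edge of \<open>star_plus\<close> is fixed at 1 and 2, so these labels
    are reserved for \<open>p\<close> and \<open>q\<close>. The interval is empty when
    \<open>L\<close> is just this pair.\<close>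
  obtain h where h: "bij_betw h (L - {p, q}) {3..?m}"
  proof -
    have "card (L - {p, q}) = card {3..?m}" using m by (simp only: card_atLeastAtMost)
    then show thesis using finite_same_card_bij[of "L - {p, q}" "{3..?m}"] assms(1) that by blast
  qed
  define f where "f = h(c := 0, p := 1, q := 2)"
  have f: "f c = 0" "f p = 1" "f q = 2" using assms(2-5) by (auto simp: f_def)
  have "f x = h x" if "x \<in> L - {p, q}" for x using that assms(2) by (auto simp: f_def)
  then have "bij_betw f (L - {p, q}) {3..?m}" using h bij_betw_cong by metis
  then have inj: "inj_on f (L - {p, q})" and img: "f ` (L - {p, q}) = {3..?m}"
    by (simp_all add: bij_betw_def)
  have L: "L = insert p (insert q (L - {p, q}))" using assms by auto
  have fL: "f ` L = {1..?m}"
  proof -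
    have "f ` L = insert 1 (insert 2 {3..?m})" by (subst L) (simp add: f img)
    also have "\<dots> = {1..?m}" using \<open>card {p, q} \<le> ?m\<close> assms(5) by auto
    finally show ?thesis .
  qed
  have "inj_on f (insert p (insert q (L - {p, q})))"
    using inj f img assms(5) by auto
  then have "inj_on f L" using L by simp
  then have "inj_on f (insert c L)" using f fL assms(2) by auto
  moreover have "f ` insert c L = {0..?m}" using f fL by auto
  moreover have "map_prod f f ` parcs H = parcs (star_plus ?m)"
    unfolding assms parcs_star_plus image_Un map_prod_image_Times by (simp add: f fL)
  ultimately show ?thesis
    using assms by (intro digraph_isoI[of _ f]) (auto simp: pverts_concrete)
qed

lemma digraph_iso_double_star:
  fixes H :: "'a pair_pre_digraph"
  assumes "finite L" "distinct [c, v, w]" "L \<inter> {c, v, w} = {}" "pverts H = L \<union> {c, v, w}"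
    "parcs H = {c} \<times> L \<union> L \<times> {c} \<union> {(c, v), (v, c), (v, w), (w, v)}"
  shows "digraph_iso H (double_star (card L) 1)"
proof -
  let ?m = "card L"
  obtain h where h: "bij_betw h L {1..?m}"
    using finite_same_card_bij[OF assms(1), of "{1..?m}"] by auto
  define f :: "'a \<Rightarrow> nat + nat" where "f = (Inl \<circ> h)(c := Inl 0, v := Inr 0, w := Inr 1)"
  have "f ` L = Inl ` h ` L" using assms(3) by (auto simp: f_def)
  then have f: "f c = Inl 0" "f v = Inr 0" "f w = Inr 1" "f ` L = Inl ` {1..?m}"
    using h assms(2) by (auto simp: f_def bij_betw_def)
  have "inj_on f L"
    using h assms(3) by (auto simp: f_def bij_betw_def inj_on_def)
  then have "inj_on f (insert c (insert v (insert w L)))" using f assms(2,3) by auto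
  moreover have "insert c (insert v (insert w L)) = pverts H" using assms(4) by auto
  moreover have "f ` pverts H = pverts (double_star ?m 1)"
    unfolding assms pverts_concrete image_Un by (auto simp: f)
  moreover have "map_prod f f ` parcs H = parcs (double_star ?m 1)"
    unfolding assms parcs_double_star_1 image_Un map_prod_image_Times by (simp add: f)
  moreover have "parcs H \<subseteq> pverts H \<times> pverts H" unfolding assms by auto
  ultimately show ?thesis by (intro digraph_isoI[of _ f]) simp_all
qed

lemma digraph_iso_cycle_graph_5:
  fixes H :: "'a pair_pre_digraph"
  assumes "distinct [p, q, r, s, t]" "pverts H = {p, q, r, s, t}"
    "parcs H = {(p, q), (q, r), (r, s), (s, t), (t, p), (q, p), (r, q), (s, r), (t, s), (p, t)}"
  shows "digraph_iso H (cycle_graph 5)"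
proof -
  \<comment> \<open>The default value 4 is the label of \<open>t\<close>.\<close>
  define f :: "'a \<Rightarrow> nat" where "f = (\<lambda>_. 4)(p := 0, q := 1, r := 2, s := 3)"
  have f: "f p = 0" "f q = 1" "f r = 2" "f s = 3" "f t = 4"
    using assms(1) by (auto simp: f_def)
  show ?thesis
  proof (rule digraph_isoI[of _ f])
    show "f ` pverts H = pverts (cycle_graph 5)"
      unfolding assms pverts_concrete by (simp add: f)
    show "map_prod f f ` parcs H = parcs (cycle_graph 5)"
      unfolding assms parcs_cycle_graph_5 by (simp add: f)
  qed (auto simp: assms inj_on_def f)
qed

text \<open>A weakening that forgets the independence conditions. It already fails in stars, stars
  plus an edge and the double stars, but holds in the 5-cycle, which is why that graph is treated
  separately.\<close>

lemma two_zeros_imp_branching_pair: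
  assumes "two_zeros E"
  obtains x y a b c d where "(x, a) \<in> E" "(x, b) \<in> E" "a \<noteq> b" "(y, c) \<in> E" "(y, d) \<in> E" "c \<noteq> d"
    "x \<noteq> y" "y \<notin> {a, b}" "x \<notin> {c, d}"
proof -
  from assms obtain x y a b c d where *: "(x, a) \<in> E" "(x, b) \<in> E" "(y, c) \<in> E" "(y, d) \<in> E"
      "x \<noteq> y" "{x, y} \<inter> {a, b, c, d} = {}" "{a, c} \<inter> {b, d} = {}"
    by (rule two_zerosE)
  show thesis by (rule that[OF *(1,2) _ *(3,4) _ *(5)]) (use *(6,7) in auto)
qed

lemma not_two_zeros_star: "\<not> two_zeros (parcs (star m))"
proof
  have centre: "x = 0" if "(x, a) \<in> parcs (star m)" "(x, b) \<in> parcs (star m)" "a \<noteq> b" for x a b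
    using that unfolding parcs_star by auto
  assume "two_zeros (parcs (star m))"
  then show False by (rule two_zeros_imp_branching_pair) (metis centre)
qed

text \<open>A zero at 1 takes 0 and 2 as its neighbours, and one at 2 takes 0 and 1, so no branching
  vertex remains for a second zero.\<close>

lemma not_two_zeros_star_plus: "\<not> two_zeros (parcs (star_plus m))"
proof
  have centre: "x = 0 \<or> x = 1 \<and> {a, b} = {0, 2} \<or> x = 2 \<and> {a, b} = {0, 1}"
    if "(x, a) \<in> parcs (star_plus m)" "(x, b) \<in> parcs (star_plus m)" "a \<noteq> b" for x a b
    using that unfolding parcs_star_plus by auto
  assume "two_zeros (parcs (star_plus m))"
  then obtain x y a b c d where x: "(x, a) \<in> parcs (star_plus m)" "(x, b) \<in> parcs (star_plus m)" "a \<noteq> b"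
      and y: "(y, c) \<in> parcs (star_plus m)" "(y, d) \<in> parcs (star_plus m)" "c \<noteq> d"
      and xy: "x \<noteq> y" "y \<notin> {a, b}" "x \<notin> {c, d}"
    by (rule two_zeros_imp_branching_pair)
  from centre[OF x] centre[OF y] xy show False by (elim disjE conjE) simp_all
qed

text \<open>Only \<open>Inl 0\<close> and \<open>Inr 0\<close> can branch, and a zero at
  \<open>Inr 0\<close> needs \<open>Inl 0\<close> as one of its neighbours.\<close>

lemma not_two_zeros_double_star: "\<not> two_zeros (parcs (double_star m 1))"
proof
  have centre: "x = Inl 0 \<or> x = Inr 0 \<and> {a, b} = {Inl 0, Inr 1}"
    if "(x, a) \<in> parcs (double_star m 1)" "(x, b) \<in> parcs (double_star m 1)" "a \<noteq> b" for x a b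
    using that unfolding parcs_double_star_1 by auto
  assume "two_zeros (parcs (double_star m 1))"
  then obtain x y a b c d where
      x: "(x, a) \<in> parcs (double_star m 1)" "(x, b) \<in> parcs (double_star m 1)" "a \<noteq> b"
      and y: "(y, c) \<in> parcs (double_star m 1)" "(y, d) \<in> parcs (double_star m 1)" "c \<noteq> d"
      and xy: "x \<noteq> y" "y \<notin> {a, b}" "x \<notin> {c, d}"
    by (rule two_zeros_imp_branching_pair)
  from centre[OF x] centre[OF y] xy show False by (elim disjE conjE) simp_all
qed

text \<open>Two nonadjacent vertices of the 5-cycle share one neighbour; their other neighbours
  would then have the same value, but they are adjacent. The proof enumerates all cases.\<close>

lemma not_two_zeros_cycle_graph_5: "\<not> two_zeros (parcs (cycle_graph 5))"
proof
  have triple: "(x, a, b) \<in> {(0, 1, 4), (1, 2, 0), (2, 3, 1), (3, 4, 2), (4, 0, 3),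
      (0, 4, 1), (1, 0, 2), (2, 1, 3), (3, 2, 4), (4, 3, 0)}"
    if "(x, a) \<in> parcs (cycle_graph 5)" "(x, b) \<in> parcs (cycle_graph 5)" "a \<noteq> b" for x a b
    using that unfolding parcs_cycle_graph_5 by (elim insertE emptyE) simp_all
  assume "two_zeros (parcs (cycle_graph 5))"
  then obtain x y a b c d where x: "(x, a) \<in> parcs (cycle_graph 5)" "(x, b) \<in> parcs (cycle_graph 5)"
      and y: "(y, c) \<in> parcs (cycle_graph 5)" "(y, d) \<in> parcs (cycle_graph 5)"
      and neq: "x \<noteq> y" "{x, y} \<inter> {a, b, c, d} = {}" "{a, c} \<inter> {b, d} = {}"
      and indep: "(a, c) \<notin> parcs (cycle_graph 5)" "(b, d) \<notin> parcs (cycle_graph 5)"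
    by (rule two_zerosE)
  have "a \<noteq> b" "c \<noteq> d" using neq by auto
  from triple[OF y \<open>c \<noteq> d\<close>] triple[OF x \<open>a \<noteq> b\<close>] neq indep show False
    unfolding parcs_cycle_graph_5 by (elim insertE emptyE) simp_all
qed

lemma branchingI: "(x, a) \<in> E \<Longrightarrow> (x, b) \<in> E \<Longrightarrow> a \<noteq> b \<Longrightarrow> branching E"
  unfolding branching_def by blast

lemma branching_concrete:
  "2 \<le> m \<Longrightarrow> branching (parcs (star m))" "2 \<le> m \<Longrightarrow> branching (parcs (star_plus m))"
  "branching (parcs (double_star m 1))" "branching (parcs (cycle_graph 5))"
  unfolding parcs_star parcs_star_plus parcs_double_star_1 parcs_cycle_graph_5
  by (rule branchingI[of 0 1 _ 2] branchingI[of "Inr 0" "Inl 0" _ "Inr 1"]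
      branchingI[of 0 1 _ 4]; simp; fail)+

text \<open>Mirrors the disjunction in the theorem, so that unfolding it closes the final
  equivalence.\<close>

definition extremal_graph :: "'a pair_pre_digraph \<Rightarrow> bool" where
  "extremal_graph H \<longleftrightarrow> (let n = card (pverts H) in
     n \<ge> 3 \<and> digraph_iso H (star (n - 1)) \<or>
     n \<ge> 3 \<and> digraph_iso H (star_plus (n - 1)) \<or>
     n \<ge> 4 \<and> digraph_iso H (double_star (n - 3) 1) \<or>
     digraph_iso H (cycle_graph 5))"

text \<open>The directions are chosen so that \<open>branching\<close> and the absence of
  \<open>two_zeros\<close> both pass from the model graph \<open>K\<close> back to
  \<open>H\<close>.\<close>

lemma digraph_iso_reflects:
  assumes "digraph_iso (with_proj H) (with_proj K)"
  shows "two_zeros (parcs H) \<Longrightarrow> two_zeros (parcs K)" "branching (parcs K) \<Longrightarrow> branching (parcs H)"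
proof -
  obtain f where wf: "pair_wf_digraph H" and f: "inj_on f (pverts H)" "parcs K = map_prod f f ` parcs H"
    using assms unfolding digraph_iso_with_proj_iff by blast
  interpret pair_wf_digraph H by (rule wf)
  have "parcs H \<subseteq> pverts H \<times> pverts H" using wellformed' by auto
  then show "two_zeros (parcs H) \<Longrightarrow> two_zeros (parcs K)" "branching (parcs K) \<Longrightarrow> branching (parcs H)"
    using two_zeros_map_prod branching_map_prod f by metis+
qed

lemma extremal_graph_local:
  assumes "extremal_graph H"
  shows "branching (parcs H)" "\<not> two_zeros (parcs H)"
proof -
  from assms consider
      (star) m where "2 \<le> m" "digraph_iso H (star m)"
    | (star_plus) m where "2 \<le> m" "digraph_iso H (star_plus m)"
    | (double_star) m where "digraph_iso H (double_star m 1)"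
    | (cycle) "digraph_iso H (cycle_graph 5)"
    unfolding extremal_graph_def Let_def by fastforce
  then have "branching (parcs H) \<and> \<not> two_zeros (parcs H)"
  proof cases
    case star
    then show ?thesis using digraph_iso_reflects[OF star(2)] branching_concrete(1) not_two_zeros_star by blast
  next
    case star_plus
    then show ?thesis
      using digraph_iso_reflects[OF star_plus(2)] branching_concrete(2) not_two_zeros_star_plus by blast
  next
    case double_star
    then show ?thesis
      using digraph_iso_reflects[OF double_star] branching_concrete(3) not_two_zeros_double_star by blast
  next
    case cycle
    then show ?thesis
      using digraph_iso_reflects[OF cycle] branching_concrete(4) not_two_zeros_cycle_graph_5 by blast
  qed
  then show "branching (parcs H)" "\<not> two_zeros (parcs H)" by blast+
qed

section \<open>From the local condition to the list of components\<close>

context pair_graph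
begin

lemma ex_extremal_graph_component:
  assumes "branching (parcs G)" "\<not> two_zeros (parcs G)"
  obtains c where "c \<in> pverts G" "extremal_graph (component_of G c)"
proof -
  interpret at_most_one_zero "parcs G"
    using assms(2) irrefl_arcs by unfold_locales (auto intro: arcs_symmetric)
  let ?C = "\<lambda>c. component_of G c"
  show thesis
  proof (cases "\<exists>p q r s t. cycle5 p q r s t")
    case True
    then obtain p q r s t where cyc: "cycle5 p q r s t" by blast
    then have "p \<in> pverts G" using in_arcsD1 by (auto simp: cycle5_def)
    moreover have "digraph_iso (?C p) (cycle_graph 5)"
      using cyc cycle5_component[OF cyc]
      by (intro digraph_iso_cycle_graph_5[of p q r s t])
        (simp_all add: cycle5_def pverts_component_of parcs_component_of)
    ultimately show thesis using that unfolding extremal_graph_def Let_def by blast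
  next
    case False
    \<comment> \<open>The maximum degree is taken over the whole type, as
      \<open>component_without_cycle5\<close> asks. That \<open>c\<close> is a vertex follows
      afterwards from its having a neighbour.\<close>
    have bound: "card (parcs G `` {x}) < Suc (card (Range (parcs G)))" for x
      using pair_finite_arcs by (auto simp: less_Suc_eq_le intro!: card_mono finite_Range)
    obtain c where max: "\<And>x. card (parcs G `` {x}) \<le> card (parcs G `` {c})"
      using ex_has_greatest_nat[of "\<lambda>_. True" undefined "\<lambda>x. card (parcs G `` {x})"] bound by blast
    obtain x a b where x: "(x, a) \<in> parcs G" "(x, b) \<in> parcs G" "a \<noteq> b"
      using assms(1) unfolding branching_def by blast
    have "card {a, b} \<le> card (parcs G `` {x})"
      using x pair_finite_arcs by (intro card_mono finite_Image) auto
    then have deg: "2 \<le> card (parcs G `` {c})" using max[of x] x(3) by simp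
    then have "parcs G `` {c} \<noteq> {}" by auto
    then have c: "c \<in> pverts G" using in_arcsD1 by blast
    have fin: "finite (pverts (?C c))"
      using pair_graph_component_of[OF c] by (simp add: pair_graph_def pair_digraph_def pair_fin_digraph_def pair_fin_digraph_axioms_def)
    note shape = pverts_component_of[of G c] parcs_component_of[of G c]
    have no_cycle: "\<not> cycle5 p q r s t" for p q r s t using False by blast
    have "extremal_graph (?C c)"
    proof (rule component_without_cycle5[OF pair_finite_arcs no_cycle max deg], goal_cases star star_plus double_star)
      case (star L)
      have "finite L" using fin star(1) shape(1) by simp
      then have "digraph_iso (?C c) (star (card L))"
        using star shape by (intro digraph_iso_star) simp_all
      moreover have "card (pverts (?C c)) = Suc (card L)" using star \<open>finite L\<close> shape(1) by simp
      ultimately show ?thesis using star(3) by (simp add: extremal_graph_def Let_def)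
    next
      case (star_plus L p q)
      have "finite L" using fin star_plus(1) shape(1) by simp
      then have "digraph_iso (?C c) (star_plus (card L))"
        using star_plus shape by (intro digraph_iso_star_plus) simp_all
      moreover have "card (pverts (?C c)) = Suc (card L)" using star_plus \<open>finite L\<close> shape(1) by simp
      moreover have "card {p, q} \<le> card L" using star_plus \<open>finite L\<close> by (intro card_mono) auto
      ultimately show ?thesis using star_plus(5) by (simp add: extremal_graph_def Let_def)
    next
      case (double_star L v w)
      have "finite L" using fin double_star(1) shape(1) by simp
      then have "digraph_iso (?C c) (double_star (card L) 1)"
        using double_star shape by (intro digraph_iso_double_star) simp_all
      moreover have "card (pverts (?C c)) = card L + card {c, v, w}"
        using double_star \<open>finite L\<close> shape(1) card_Un_disjoint[of L "{c, v, w}"] by simp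
      then have "card (pverts (?C c)) = card L + 3" using double_star(2) by simp
      ultimately show ?thesis using double_star(4) by (simp add: extremal_graph_def Let_def)
    qed
    with c that show thesis by blast
  qed
qed

text \<open>If \<open>v\<close> has a neighbour \<open>w\<close>, each of the two is the only
  neighbour of the other, so the pair is closed under adjacency.\<close>

lemma component_of_complete:
  assumes "v \<in> pverts G"
    and deg: "\<And>x a b. (v, x) \<in> (parcs G)\<^sup>* \<Longrightarrow> (x, a) \<in> parcs G \<Longrightarrow> (x, b) \<in> parcs G \<Longrightarrow> a = b"
  shows "complete_digraph 1 (component_of G v) \<or> complete_digraph 2 (component_of G v)"
proof (cases "parcs G `` {v} = {}")
  case True
  then have "(parcs G)\<^sup>* `` {v} = {v}" by (intro rtrancl_Image_singleton_eqI) auto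
  then show ?thesis
    using True irrefl_arcs by (auto simp: complete_digraph_pair_def pverts_component_of parcs_component_of)
next
  case False
  then obtain w where vw: "(v, w) \<in> parcs G" by blast
  then have wv: "(w, v) \<in> parcs G" by (rule arcs_symmetric)
  have "v \<noteq> w" using vw irrefl_arcs by blast
  have nbr: "(v, y) \<in> parcs G \<Longrightarrow> y = w" "(w, y) \<in> parcs G \<Longrightarrow> y = v" for y
    using deg[of v y w] deg[of w y v] vw wv by blast+
  have "(parcs G)\<^sup>* `` {v} = {v, w}"
    using vw by (intro rtrancl_Image_singleton_eqI) (auto dest: nbr)
  moreover have "parcs G \<inter> {v, w} \<times> {v, w} = {(v, w), (w, v)}"
    using vw wv irrefl_arcs by auto
  moreover have "{(x, y). (x, y) \<in> {v, w} \<times> {v, w} \<and> x \<noteq> y} = {(v, w), (w, v)}"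
    using \<open>v \<noteq> w\<close> by auto
  ultimately have "complete_digraph 2 (component_of G v)"
    using \<open>v \<noteq> w\<close> by (simp add: complete_digraph_pair_def pverts_component_of parcs_component_of)
  then show ?thesis ..
qed

text \<open>Vertices reachable from \<open>x\<close> are neither equal nor adjacent to those
  reachable from \<open>y\<close>, so every disjointness and independence condition between the two
  sides is automatic.\<close>

lemma two_zeros_if_unreachable:
  assumes x: "(x, a) \<in> parcs G" "(x, b) \<in> parcs G" "a \<noteq> b"
    and y: "(y, c) \<in> parcs G" "(y, d) \<in> parcs G" "c \<noteq> d" and xy: "(x, y) \<notin> (parcs G)\<^sup>*"
  shows "two_zeros (parcs G)"
proof -
  have sep: "u \<noteq> v" "(u, v) \<notin> parcs G" if "(x, u) \<in> (parcs G)\<^sup>*" "(y, v) \<in> (parcs G)\<^sup>*" for u v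
  proof -
    have "(u, v) \<notin> (parcs G)\<^sup>*"
      using xy rtrancl_trans[OF rtrancl_trans[OF that(1)] rtrancl_arcs_symmetric[OF that(2)]] by blast
    then show "u \<noteq> v" "(u, v) \<notin> parcs G" by auto
  qed
  have "(x, a) \<in> (parcs G)\<^sup>*" "(x, b) \<in> (parcs G)\<^sup>*" "(y, c) \<in> (parcs G)\<^sup>*" "(y, d) \<in> (parcs G)\<^sup>*"
    using x y by auto
  note s = sep[OF rtrancl_refl rtrancl_refl] sep[OF rtrancl_refl this(3)] sep[OF rtrancl_refl this(4)]
    sep[OF this(1) rtrancl_refl] sep[OF this(2) rtrancl_refl]
    sep[OF this(1,3)] sep[OF this(2,4)] sep[OF this(1,4)] sep[OF this(2,3)]
  have "x \<noteq> a" "x \<noteq> b" "y \<noteq> c" "y \<noteq> d" using x y irrefl_arcs by blast+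
  then show ?thesis
    using s x(3) y(3) by (intro two_zerosI[OF x(1,2) y(1,2)]) auto
qed

lemma branching_not_in_small_component:
  assumes x: "(x, a) \<in> parcs G" "(x, b) \<in> parcs G" "a \<noteq> b"
  shows "\<not> (complete_digraph 1 (component_of G x) \<or> complete_digraph 2 (component_of G x))"
proof
  assume *: "complete_digraph 1 (component_of G x) \<or> complete_digraph 2 (component_of G x)"
  then have "finite (pverts (component_of G x))" "card (pverts (component_of G x)) \<le> 2"
    by (auto simp: complete_digraph_pair_def)
  moreover have "{x, a, b} \<subseteq> pverts (component_of G x)"
    using x by (auto simp: pverts_component_of)
  ultimately have "card {x, a, b} \<le> 2" by (meson card_mono order_trans)
  moreover have "x \<noteq> a" "x \<noteq> b" using x irrefl_arcs by blast+
  ultimately show False using x(3) by simp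
qed

lemma local_iff_extremal_graph_component:
  "branching (parcs G) \<and> \<not> two_zeros (parcs G) \<longleftrightarrow>
     (\<exists>c \<in> pverts G. extremal_graph (component_of G c) \<and>
       (\<forall>v \<in> pverts G. component_of G v \<noteq> component_of G c \<longrightarrow>
          complete_digraph 1 (component_of G v) \<or> complete_digraph 2 (component_of G v)))"
  (is "?L \<longleftrightarrow> ?R")
proof
  assume L: ?L
  then obtain c where c: "c \<in> pverts G" "extremal_graph (component_of G c)"
    using ex_extremal_graph_component by blast
  \<comment> \<open>The extremal component contains a branching vertex \<open>x\<close>; a branching
    vertex in any other component would pair with it to give two zeros.\<close>
  obtain x a b where x: "(x, a) \<in> parcs G" "(x, b) \<in> parcs G" "a \<noteq> b" "(c, x) \<in> (parcs G)\<^sup>*"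
    using extremal_graph_local(1)[OF c(2)] unfolding branching_def parcs_component_of by blast
  have "complete_digraph 1 (component_of G v) \<or> complete_digraph 2 (component_of G v)"
    if v: "v \<in> pverts G" "component_of G v \<noteq> component_of G c" for v
  proof (rule component_of_complete[OF v(1)], rule ccontr)
    fix y d e assume y: "(v, y) \<in> (parcs G)\<^sup>*" "(y, d) \<in> parcs G" "(y, e) \<in> parcs G" "d \<noteq> e"
    have "(x, y) \<notin> (parcs G)\<^sup>*"
      using component_of_eq[OF x(4)] component_of_eq[OF y(1)] component_of_eq[of x y] v(2) by auto
    from two_zeros_if_unreachable[OF x(1-3) y(2-4) this] L show False by blast
  qed
  with c show ?R by blast
next
  assume ?R
  then obtain c where c: "c \<in> pverts G" "extremal_graph (component_of G c)"
    and others: "\<And>v. v \<in> pverts G \<Longrightarrow> component_of G v \<noteq> component_of G c \<Longrightarrow>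
      complete_digraph 1 (component_of G v) \<or> complete_digraph 2 (component_of G v)"
    by blast
  let ?S = "(parcs G)\<^sup>* `` {c}"
  have "branching (parcs G)"
    using extremal_graph_local(1)[OF c(2)] unfolding branching_def parcs_component_of by blast
  moreover have "\<not> two_zeros (parcs G)"
  proof
    assume "two_zeros (parcs G)"
    then obtain x y a b d e where *: "(x, a) \<in> parcs G" "(x, b) \<in> parcs G"
        "(y, d) \<in> parcs G" "(y, e) \<in> parcs G" "x \<noteq> y" "{x, y} \<inter> {a, b, d, e} = {}"
        "{a, d} \<inter> {b, e} = {}" "(a, d) \<notin> parcs G" "(b, e) \<notin> parcs G"
      by (rule two_zerosE)
    \<comment> \<open>A branching vertex together with two neighbours does not fit into a component
      \<open>K\<^sub>1\<close> or \<open>K\<^sub>2\<close>. Hence both zeros, with all their chosen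
      neighbours, lie in the extremal component.\<close>
    have in_S: "u \<in> ?S \<and> p \<in> ?S \<and> q \<in> ?S" if u: "(u, p) \<in> parcs G" "(u, q) \<in> parcs G" "p \<noteq> q" for u p q
    proof -
      have "component_of G u = component_of G c"
        using others[OF in_arcsD1[OF u(1)]] branching_not_in_small_component[OF u] by blast
      then have "?S = (parcs G)\<^sup>* `` {u}" using pverts_component_of by metis
      then show ?thesis using u by auto
    qed
    have "a \<noteq> b" "d \<noteq> e" using *(7) by auto
    then have "x \<in> ?S" "a \<in> ?S" "b \<in> ?S" "y \<in> ?S" "d \<in> ?S" "e \<in> ?S"
      using in_S[OF *(1,2)] in_S[OF *(3,4)] by blast+
    then have "two_zeros (parcs (component_of G c))"
      using *(1-4,8,9) by (intro two_zerosI[OF _ _ _ _ *(5,6,7)]) (simp_all add: parcs_component_of)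
    with extremal_graph_local(2)[OF c(2)] show False by blast
  qed
  ultimately show ?L by blast
qed

end

theorem theorem4:
  fixes G :: "'a pair_pre_digraph" and n :: nat
  assumes "pair_graph G" and "card (pverts G) = n" and "n \<ge> 3"
  shows "gamma_ri2 G = n - 1 \<longleftrightarrow>
    (\<exists>G\<^sub>1 \<in> connected_components G.
       (let n\<^sub>1 = card (verts G\<^sub>1) in
          n\<^sub>1 \<ge> 3 \<and> digraph_iso G\<^sub>1 (star (n\<^sub>1 - 1)) \<or>
          n\<^sub>1 \<ge> 3 \<and> digraph_iso G\<^sub>1 (star_plus (n\<^sub>1 - 1)) \<or>
          n\<^sub>1 \<ge> 4 \<and> digraph_iso G\<^sub>1 (double_star (n\<^sub>1 - 3) 1) \<or>
          digraph_iso G\<^sub>1 (cycle_graph 5)) \<and>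
       (\<forall>H \<in> connected_components G - {G\<^sub>1}. complete_digraph 1 H \<or> complete_digraph 2 H))"
proof -
  interpret pair_graph G by (rule assms(1))
  have "gamma_ri2 G = n - 1 \<longleftrightarrow> branching (parcs G) \<and> \<not> two_zeros (parcs G)"
    using gamma_ri2_eq_iff assms by simp
  \<comment> \<open>Quantifiers over components become quantifiers over vertices; since
    \<open>with_proj\<close> is injective, removing one component means excluding the vertices with
    the same \<open>component_of\<close>.\<close>
  moreover have "(\<forall>H \<in> connected_components G - {with_proj (component_of G c)}. P H) \<longleftrightarrow>
      (\<forall>v \<in> pverts G. component_of G v \<noteq> component_of G c \<longrightarrow> P (with_proj (component_of G v)))" for c P
    unfolding connected_components_eq by (auto simp: with_proj_eq_iff)
  moreover have "(\<exists>H \<in> connected_components G. P H) \<longleftrightarrow> (\<exists>c \<in> pverts G. P (with_proj (component_of G c)))" for P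
    unfolding connected_components_eq by blast
  ultimately show ?thesis
    by (simp only: local_iff_extremal_graph_component extremal_graph_def with_proj_simps(1))
qed

end
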